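(* Let $n\ge2$, $u\in C^\infty(S^1,V_n)$, and let $g:S^1\to GL(n,\mathbb{R})$ be smooth with $g^{-1}g_x=b+u$, where $b=\sum_{i=1}^{n-1}e_{i+1,i}$. Let $v\in C^\infty(S^1,V_n^t)$. If $(J_2)_u(v)=0$, then there is a constant $c_0\in sl(n,\mathbb{R})$ such that $v=\pi_0(g^{-1}c_0g)$.
   Context: $V_n=\bigoplus_{i=1}^{n-1}\mathbb{R}e_{in}$, $V_n^t=\bigoplus_{i=1}^{n-1}\mathbb{R}e_{ni}$, $[\partial_x+A,B]=B_x+[A,B]$. The canonical projection is $\pi_0:sl(n,\mathbb{R})\to V_n^t$, $\pi_0(y)=\sum_{i=1}^{n-1}y_{ni}e_{ni}$. For $v\in C^\infty(S^1,V_n^t)$, $P_u(v)=C$ is the unique smooth $sl(n,\mathbb{R})$-valued map with $\pi_0(C)=v$ and $[\partial_x+b+u,C]\in C^\infty(S^1,V_n)$. The second Poisson operator is $(J_2)_u:C^\infty(S^1,V_n^t)\to C^\infty(S^1,V_n)$, $(J_2)_u(v)=[\partial_x+b+u,P_u(v)]$. *)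

theory Defs
  imports "HOL-Analysis.Derivative" "Jordan_Normal_Form.Gauss_Jordan_Elimination"
begin

text \<open>
  Matrix indices are 0-based: the entry written \<open>y\<^sub>i\<^sub>j\<close> in mathematical notation
  (\<open>1 \<le> i, j \<le> n\<close>) is \<open>y $$ (i - 1, j - 1)\<close>.
\<close>

definition V_n :: "nat \<Rightarrow> real mat set" where
  "V_n n = {mat n n (\<lambda>(i, j). if i < n - 1 \<and> j = n - 1 then a i else 0) | a. True}"

definition V_n_t :: "nat \<Rightarrow> real mat set" where
  "V_n_t n = {mat n n (\<lambda>(i, j). if i = n - 1 \<and> j < n - 1 then a j else 0) | a. True}"

definition sl :: "nat \<Rightarrow> real mat set" where
  "sl n = {A \<in> carrier_mat n n. (\<Sum>i<n. A $$ (i, i)) = 0}"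

definition GL :: "nat \<Rightarrow> real mat set" where
  "GL n = {A \<in> carrier_mat n n. invertible_mat A}"

definition b_mat :: "nat \<Rightarrow> real mat" where
  "b_mat n = mat n n (\<lambda>(i, j). if i = j + 1 then 1 else 0)"

definition pi0 :: "nat \<Rightarrow> real mat \<Rightarrow> real mat" where
  "pi0 n y = mat n n (\<lambda>(i, j). if i = n - 1 \<and> j < n - 1 then y $$ (i, j) else 0)"

definition minv :: "real mat \<Rightarrow> real mat" where
  "minv A = the (mat_inverse A)"

definition smooth :: "(real \<Rightarrow> real) \<Rightarrow> bool" where
  "smooth f \<longleftrightarrow> (\<forall>k x. (deriv ^^ k) f field_differentiable at x)"

text \<open>
  \<open>S\<^sup>1 = \<real> / 2\<pi>\<int>\<close> with coordinate \<open>x\<close>: maps on the circle are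
  \<open>2\<pi>\<close>-periodic maps on the real line. All the sets \<open>X\<close> used below consist of
  \<open>n \<times> n\<close> matrices, on which smoothness is smoothness of every entry.
\<close>

definition Cinf_S1 :: "nat \<Rightarrow> real mat set \<Rightarrow> (real \<Rightarrow> real mat) set" where
  "Cinf_S1 n X = {A. (\<forall>x. A x \<in> X) \<and> (\<forall>x. A (x + 2 * pi) = A x) \<and>
                     (\<forall>i<n. \<forall>j<n. smooth (\<lambda>x. A x $$ (i, j)))}"

definition mderiv :: "nat \<Rightarrow> (real \<Rightarrow> real mat) \<Rightarrow> real \<Rightarrow> real mat" where
  "mderiv n A x = mat n n (\<lambda>(i, j). deriv (\<lambda>t. A t $$ (i, j)) x)"

text \<open>\<open>lax n A B\<close> is \<open>[\<partial>\<^sub>x + A, B] = B\<^sub>x + [A, B]\<close>.\<close>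

definition lax :: "nat \<Rightarrow> (real \<Rightarrow> real mat) \<Rightarrow> (real \<Rightarrow> real mat) \<Rightarrow> real \<Rightarrow> real mat" where
  "lax n A B x = mderiv n B x + (A x * B x - B x * A x)"

definition P_u :: "nat \<Rightarrow> (real \<Rightarrow> real mat) \<Rightarrow> (real \<Rightarrow> real mat) \<Rightarrow> real \<Rightarrow> real mat" where
  "P_u n u v = (THE C. C \<in> Cinf_S1 n (sl n) \<and> (\<forall>x. pi0 n (C x) = v x) \<and>
                     lax n (\<lambda>x. b_mat n + u x) C \<in> Cinf_S1 n (V_n n))"

definition J2_u :: "nat \<Rightarrow> (real \<Rightarrow> real mat) \<Rightarrow> (real \<Rightarrow> real mat) \<Rightarrow> real \<Rightarrow> real mat" where
  "J2_u n u v = lax n (\<lambda>x. b_mat n + u x) (P_u n u v)"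

end

theory Submission
  imports Defs "Jordan_Normal_Form.Determinant"
begin

text \<open>
  The condition \<open>[\<partial>\<^sub>x + b + u, C] \<in> V\<^sub>n\<close> says that each column of \<open>C\<close> is obtained from the previous
  one by \<open>T = \<partial>\<^sub>x + b + u\<close>, so \<open>C\<close> is determined by its first column \<open>c\<close>. Since \<open>T\<close> shifts the support
  of a column down by one and keeps the leading entry, prescribing the last row of \<open>C\<close> determines all
  entries of \<open>c\<close> but the top one, and the trace condition determines that one; the remaining corner
  entry of \<open>[\<partial>\<^sub>x + b + u, C]\<close> vanishes because this commutator has trace zero. So \<open>P_u\<close> is well
  defined. If \<open>C = P_u(v)\<close> satisfies \<open>[\<partial>\<^sub>x + b + u, C] = 0\<close>, then \<open>g C g\<^sup>-\<^sup>1\<close> has derivative zero,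
  and its constant value is \<open>c\<^sub>0\<close>.
\<close>

section \<open>Smooth periodic functions\<close>

text \<open>\<open>smooth\<close> speaks of all iterated derivatives, so a direct proof for products
  would need the Leibniz formula. This class of sums and products of smooth functions is stable
  under \<open>deriv\<close>, so every iterated derivative stays inside it and is
  differentiable.\<close>

inductive smooth_closure :: "(real \<Rightarrow> real) \<Rightarrow> bool" where
  base: "smooth f \<Longrightarrow> smooth_closure f"
| add: "smooth_closure f \<Longrightarrow> smooth_closure g \<Longrightarrow> smooth_closure (\<lambda>x. f x + g x)"
| mult: "smooth_closure f \<Longrightarrow> smooth_closure g \<Longrightarrow> smooth_closure (\<lambda>x. f x * g x)"

lemma smooth_differentiable: "smooth f \<Longrightarrow> f field_differentiable at x"
  unfolding smooth_def by (metis funpow_0)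

lemma smooth_deriv: "smooth f \<Longrightarrow> smooth (deriv f)"
  unfolding smooth_def by (metis comp_apply funpow_Suc_right)

lemma smooth_closure_step:
  "smooth_closure f \<Longrightarrow> (\<forall>x. f field_differentiable at x) \<and> smooth_closure (deriv f)"
proof (induction rule: smooth_closure.induct)
  case (base f)
  then show ?case by (simp add: smooth_differentiable smooth_deriv smooth_closure.base)
next
  case (add f g)
  have "deriv (\<lambda>x. f x + g x) = (\<lambda>x. deriv f x + deriv g x)"
    using add.IH by (simp add: fun_eq_iff)
  then show ?case
    using add.IH by (simp add: field_differentiable_add smooth_closure.add)
next
  case (mult f g)
  have "deriv (\<lambda>x. f x * g x) = (\<lambda>x. f x * deriv g x + deriv f x * g x)"
    using mult.IH by (simp add: fun_eq_iff)
  then show ?case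
    using mult by (simp add: field_differentiable_mult smooth_closure.add smooth_closure.mult)
qed

lemma smooth_closure_smooth: "smooth f" if "smooth_closure f"
proof -
  have "smooth_closure ((deriv ^^ k) f)" for k
    by (induction k) (use that smooth_closure_step in auto)
  then show ?thesis
    unfolding smooth_def using smooth_closure_step by blast
qed

lemma smooth_add: "smooth f \<Longrightarrow> smooth g \<Longrightarrow> smooth (\<lambda>x. f x + g x)"
  by (simp add: smooth_closure_smooth smooth_closure.base smooth_closure.add)

lemma smooth_mult: "smooth f \<Longrightarrow> smooth g \<Longrightarrow> smooth (\<lambda>x. f x * g x)"
  by (simp add: smooth_closure_smooth smooth_closure.base smooth_closure.mult)

lemma smooth_const: "smooth (\<lambda>x. c)"
proof -
  \<comment> \<open>Some constant \<open>d\<close> is asserted rather than a fixed one, because the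
    value is \<open>c\<close> for \<open>k = 0\<close> and 0 afterwards.\<close>
  have "\<exists>d. (deriv ^^ k) (\<lambda>x::real. c) = (\<lambda>x. d)" for k
  proof (induction k)
    case (Suc k)
    then obtain d where d: "(deriv ^^ k) (\<lambda>x::real. c) = (\<lambda>x. d)"
      by blast
    show ?case
      by (intro exI[of _ 0]) (simp add: d fun_eq_iff)
  qed auto
  then show ?thesis
    unfolding smooth_def by (metis field_differentiable_const)
qed

lemma deriv_sum_on:
  assumes "\<And>i. i \<in> I \<Longrightarrow> f i field_differentiable at x"
  shows "deriv (\<lambda>t. \<Sum>i\<in>I. f i t) x = (\<Sum>i\<in>I. deriv (f i) x)"
  using assms by (intro DERIV_imp_deriv DERIV_sum) (simp add: field_differentiable_derivI)

text \<open>Scalar counterpart of \<open>Cinf_S1\<close>: a function on the circle, to which matrix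
  statements are reduced entry by entry.\<close>

definition smooth_periodic :: "(real \<Rightarrow> real) \<Rightarrow> bool" where
  "smooth_periodic f \<longleftrightarrow> smooth f \<and> (\<forall>x. f (x + 2 * pi) = f x)"

lemma smooth_periodic_smooth: "smooth_periodic f \<Longrightarrow> smooth f"
  by (simp add: smooth_periodic_def)

lemma smooth_periodic_differentiable: "smooth_periodic f \<Longrightarrow> f field_differentiable at x"
  by (simp add: smooth_periodic_def smooth_differentiable)

lemma smooth_periodic_const: "smooth_periodic (\<lambda>x. c)"
  by (simp add: smooth_periodic_def smooth_const)

lemma smooth_periodic_add:
  "smooth_periodic f \<Longrightarrow> smooth_periodic g \<Longrightarrow> smooth_periodic (\<lambda>x. f x + g x)"
  by (simp add: smooth_periodic_def smooth_add)

lemma smooth_periodic_mult: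
  "smooth_periodic f \<Longrightarrow> smooth_periodic g \<Longrightarrow> smooth_periodic (\<lambda>x. f x * g x)"
  by (simp add: smooth_periodic_def smooth_mult)

lemma smooth_periodic_diff:
  assumes "smooth_periodic f" "smooth_periodic g"
  shows "smooth_periodic (\<lambda>x. f x - g x)"
  using smooth_periodic_add[OF assms(1) smooth_periodic_mult[OF smooth_periodic_const[of "-1"] assms(2)]]
  by simp

lemma smooth_periodic_sum:
  "(\<And>i. i \<in> I \<Longrightarrow> smooth_periodic (f i)) \<Longrightarrow> smooth_periodic (\<lambda>x. \<Sum>i\<in>I. f i x)"
  by (induction I rule: infinite_finite_induct)
    (simp_all add: smooth_periodic_const smooth_periodic_add)

lemma smooth_periodic_deriv: "smooth_periodic (deriv f)" if "smooth_periodic f"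
proof -
  have "deriv f (x + 2 * pi) = deriv f x" for x
  proof -
    have "(f has_field_derivative deriv f (x + 2 * pi)) (at (x + 2 * pi))"
      using that smooth_periodic_differentiable field_differentiable_derivI by blast
    then have "((\<lambda>t. f (t + 2 * pi)) has_field_derivative deriv f (x + 2 * pi)) (at x)"
      by (simp add: DERIV_shift)
    then show ?thesis
      using that by (simp add: smooth_periodic_def DERIV_imp_deriv)
  qed
  then show ?thesis
    using that by (simp add: smooth_periodic_def smooth_deriv)
qed

section \<open>The companion operator\<close>

text \<open>
  On column vectors \<open>c = (c\<^sub>0, \<dots>, c\<^bsub>n-1\<^esub>)\<close> this is \<open>c \<mapsto> c\<^sub>x + (b + u) c\<close>, where
  \<open>U\<close> is the last column of \<open>u\<close>.
\<close>

definition companion_op ::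
  "nat \<Rightarrow> (nat \<Rightarrow> real \<Rightarrow> real) \<Rightarrow> (nat \<Rightarrow> real \<Rightarrow> real) \<Rightarrow> nat \<Rightarrow> real \<Rightarrow> real" where
  "companion_op n U c i x =
     deriv (c i) x + (if i = 0 then 0 else c (i - 1) x) + U i x * c (n - 1) x"

lemma companion_op_smooth_periodic:
  assumes "\<And>i. smooth_periodic (U i)" "\<And>i. smooth_periodic (c i)"
  shows "smooth_periodic (companion_op n U c i)"
  unfolding companion_op_def[abs_def] using assms
  by (cases "i = 0")
    (simp_all add: smooth_periodic_add smooth_periodic_mult smooth_periodic_deriv smooth_periodic_const)

lemma companion_pow_smooth_periodic:
  assumes "\<And>i. smooth_periodic (U i)" "\<And>i. smooth_periodic (c i)"
  shows "smooth_periodic ((companion_op n U ^^ j) c i)"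
  by (induction j arbitrary: i) (simp_all add: assms companion_op_smooth_periodic)

lemma companion_op_add:
  assumes "\<And>i. smooth_periodic (c i)" "\<And>i. smooth_periodic (d i)"
  shows "companion_op n U (\<lambda>i x. c i x + d i x) = (\<lambda>i x. companion_op n U c i x + companion_op n U d i x)"
proof (intro ext)
  fix i x
  have "deriv (\<lambda>x. c i x + d i x) x = deriv (c i) x + deriv (d i) x"
    by (intro deriv_add smooth_periodic_differentiable assms)
  then show "companion_op n U (\<lambda>i x. c i x + d i x) i x = companion_op n U c i x + companion_op n U d i x"
    by (simp add: companion_op_def algebra_simps)
qed

lemma companion_pow_add:
  assumes "\<And>i. smooth_periodic (U i)" "\<And>i. smooth_periodic (c i)" "\<And>i. smooth_periodic (d i)"
  shows "(companion_op n U ^^ j) (\<lambda>i x. c i x + d i x) =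
    (\<lambda>i x. (companion_op n U ^^ j) c i x + (companion_op n U ^^ j) d i x)"
  by (induction j) (simp_all add: companion_op_add companion_pow_smooth_periodic assms)

text \<open>Additivity alone suffices: apply it to \<open>c = (c - d) + d\<close>.\<close>

lemma companion_pow_diff:
  assumes "\<And>i. smooth_periodic (U i)" "\<And>i. smooth_periodic (c i)" "\<And>i. smooth_periodic (d i)"
  shows "(companion_op n U ^^ j) (\<lambda>i x. c i x - d i x) =
    (\<lambda>i x. (companion_op n U ^^ j) c i x - (companion_op n U ^^ j) d i x)"
proof -
  have "(companion_op n U ^^ j) (\<lambda>i x. (c i x - d i x) + d i x) =
      (\<lambda>i x. (companion_op n U ^^ j) (\<lambda>i x. c i x - d i x) i x + (companion_op n U ^^ j) d i x)"
    by (intro companion_pow_add smooth_periodic_diff assms)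
  then show ?thesis
    by (simp add: fun_eq_iff)
qed

lemma companion_op_support:
  assumes zero: "\<And>k. m < k \<Longrightarrow> k < n \<Longrightarrow> c k = (\<lambda>x. 0)" and "Suc m < n"
  shows "companion_op n U c (Suc m) x = c m x"
    and "Suc m < k \<Longrightarrow> k < n \<Longrightarrow> companion_op n U c k x = 0"
proof -
  \<comment> \<open>Since \<open>Suc m < n\<close>, the last entry lies beyond the support, so the
    \<open>U\<close> term drops out. The entries vanish as functions, so their derivatives vanish
    too.\<close>
  have "c (n - Suc 0) = (\<lambda>x. 0)" "c (Suc m) = (\<lambda>x. 0)"
    using assms by auto
  then show "companion_op n U c (Suc m) x = c m x"
    by (simp add: companion_op_def)
  assume k: "Suc m < k" "k < n"
  then have "c k = (\<lambda>x. 0)" "c (k - Suc 0) = (\<lambda>x. 0)"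
    using zero by auto
  then show "companion_op n U c k x = 0"
    using k \<open>c (n - Suc 0) = _\<close> by (simp add: companion_op_def)
qed

text \<open>Each application moves the leading entry down by one. As \<open>i + j < n\<close>, the
  support reaches the last entry at the earliest after the final application, so \<open>U\<close>
  never contributes to the entries in question. Both claims go through one induction, since each
  step for the leading entry uses the zeros below it.\<close>

lemma companion_pow_support:
  assumes supp: "\<And>k x. i < k \<Longrightarrow> k < n \<Longrightarrow> c k x = 0" and "i + j < n"
  shows "(companion_op n U ^^ j) c (i + j) x = c i x"
    and "i + j < k \<Longrightarrow> k < n \<Longrightarrow> (companion_op n U ^^ j) c k x = 0"
proof -
  have "(\<forall>x. (companion_op n U ^^ j) c (i + j) x = c i x) \<and>
      (\<forall>k x. i + j < k \<longrightarrow> k < n \<longrightarrow> (companion_op n U ^^ j) c k x = 0)"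
    using \<open>i + j < n\<close>
  proof (induction j)
    case 0
    then show ?case using supp by simp
  next
    case (Suc j)
    let ?d = "(companion_op n U ^^ j) c"
    have top: "?d (i + j) x = c i x" for x
      using Suc by simp
    have zero: "?d k = (\<lambda>x. 0)" if "i + j < k" "k < n" for k
      using Suc that by (simp add: fun_eq_iff)
    show ?case
      using companion_op_support[of "i + j" n ?d, OF zero] Suc.prems by (simp add: top)
  qed
  then show "(companion_op n U ^^ j) c (i + j) x = c i x"
    and "i + j < k \<Longrightarrow> k < n \<Longrightarrow> (companion_op n U ^^ j) c k x = 0"
    by auto
qed

text \<open>Triangular elimination from the bottom entry upwards; the last-row conditions remove
  every entry except \<open>c 0\<close>, and the trace condition removes that one.\<close>

lemma companion_unique:
  assumes row: "\<And>j x. j < n - 1 \<Longrightarrow> (companion_op n U ^^ j) c (n - 1) x = 0"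
    and trace: "\<And>x. (\<Sum>j<n. (companion_op n U ^^ j) c j x) = 0"
    and "k < n"
  shows "c k x = 0"
proof -
  \<comment> \<open>Here \<open>m\<close> counts the bottom entries already known to vanish. Then
    \<open>c (n - 1 - m)\<close> is the leading entry, and the \<open>m\<close>-th power carries it
    to the last row, where it is 0.\<close>
  have upper: "\<forall>k x. n - 1 - m < k \<longrightarrow> k < n \<longrightarrow> c k x = 0" if "m \<le> n - 1" for m
    using that
  proof (induction m)
    case (Suc m)
    have "c (n - 1 - m) x = 0" for x
      using companion_pow_support(1)[of "n - 1 - m" n c m U x] row[of m x] Suc by auto
    moreover have "k = n - 1 - m \<or> n - 1 - m < k" if "n - 1 - Suc m < k" for k
      using that by linarith
    ultimately show ?case
      using Suc by (metis Suc_leD)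
  qed auto
  have supp: "0 < k \<Longrightarrow> k < n \<Longrightarrow> c k x = 0" for k x
    using upper[of "n - 1"] by simp
  \<comment> \<open>With only \<open>c 0\<close> left, the \<open>j\<close>-th power has exactly
    \<open>c 0\<close> in position \<open>j\<close>, so the trace is \<open>n\<close> times
    \<open>c 0\<close>.\<close>
  have "(\<Sum>j<n. (companion_op n U ^^ j) c j x) = (\<Sum>j<n. c 0 x)"
    using companion_pow_support(1)[of 0 n c _ U x] supp by (intro sum.cong) auto
  then have "c 0 x = 0"
    using trace[of x] \<open>k < n\<close> by simp
  then show ?thesis
    using supp \<open>k < n\<close> by (cases "k = 0") auto
qed

text \<open>The same elimination solves the inhomogeneous system: the last-row conditions are met
  one by one, each by correcting a single entry of \<open>c\<close> without disturbing those already
  met.\<close>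

lemma companion_exists:
  assumes U: "\<And>i. smooth_periodic (U i)" and v: "\<And>j. j < n - 1 \<Longrightarrow> smooth_periodic (v j)"
    and "0 < n"
  obtains c where "\<And>i. smooth_periodic (c i)"
    "\<And>j x. j < n - 1 \<Longrightarrow> (companion_op n U ^^ j) c (n - 1) x = v j x"
    "\<And>x. (\<Sum>j<n. (companion_op n U ^^ j) c j x) = 0"
proof -
  define e where "e i w = (\<lambda>k x. if k = i then w x else 0)" for i :: nat and w :: "real \<Rightarrow> real"
  have e_sp: "smooth_periodic (e i w k)" if "smooth_periodic w" for i w k
    unfolding e_def using that smooth_periodic_const by (cases "k = i") simp_all
  have e_top: "(companion_op n U ^^ j) (e i w) (i + j) x = w x" if "i + j < n" for i j w x
    using companion_pow_support(1)[of i n "e i w" j U x] that by (simp add: e_def)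
  have e_zero: "(companion_op n U ^^ j) (e i w) k x = 0" if "i + j < k" "k < n" for i j w k x
    using companion_pow_support(2)[of i n "e i w" j k U x] that by (simp add: e_def)
  have "\<exists>c. (\<forall>i. smooth_periodic (c i)) \<and>
      (\<forall>j<m. \<forall>x. (companion_op n U ^^ j) c (n - 1) x = v j x)" if "m \<le> n - 1" for m
    using that
  proof (induction m)
    case 0
    then show ?case by (intro exI[of _ "\<lambda>i x. 0"]) (simp add: smooth_periodic_const)
  next
    case (Suc m)
    then obtain c where c: "\<And>i. smooth_periodic (c i)"
      "\<And>j x. j < m \<Longrightarrow> (companion_op n U ^^ j) c (n - 1) x = v j x"
      by auto
    \<comment> \<open>\<open>w\<close> is the defect in condition \<open>m\<close>. Placed at entry
      \<open>i\<close> with \<open>i + m = n - 1\<close>, it arrives in the last row exactly under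
      the \<open>m\<close>-th power; for \<open>j < m\<close> it has not got that far.\<close>
    define w where "w x = v m x - (companion_op n U ^^ m) c (n - 1) x" for x
    define i where "i = n - 1 - m"
    have i: "i + m = n - 1" using Suc.prems by (simp add: i_def)
    have w: "smooth_periodic w"
      unfolding w_def using Suc.prems
      by (intro smooth_periodic_diff v companion_pow_smooth_periodic U c(1)) simp
    have "(companion_op n U ^^ j) (\<lambda>k x. c k x + e i w k x) (n - 1) x = v j x" if "j < Suc m" for j x
    proof (cases "j = m")
      case True
      then show ?thesis
        using companion_pow_add[where n = n and j = j, OF U c(1) e_sp[OF w]] e_top[of i m w x] i \<open>0 < n\<close>
        by (simp add: w_def)
    next
      case False
      then show ?thesis
        using companion_pow_add[where n = n and j = j, OF U c(1) e_sp[OF w]] e_zero[of i j "n - 1" w x] i \<open>0 < n\<close> c(2)[of j x] that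
        by simp
    qed
    then show ?case
      using smooth_periodic_add[OF c(1) e_sp[OF w]] by (intro exI[of _ "\<lambda>k x. c k x + e i w k x"]) simp
  qed
  then obtain c where c: "\<And>i. smooth_periodic (c i)"
    "\<And>j x. j < n - 1 \<Longrightarrow> (companion_op n U ^^ j) c (n - 1) x = v j x"
    by blast
  \<comment> \<open>A function \<open>w\<close> at the top entry adds \<open>w\<close> to each of
    the \<open>n\<close> diagonal terms, whence the factor -1/n. For \<open>j < n - 1\<close> it
    does not reach the last row, so those conditions survive.\<close>
  define w where "w x = (- 1 / real n) * (\<Sum>j<n. (companion_op n U ^^ j) c j x)" for x
  have w: "smooth_periodic w"
    unfolding w_def
    by (intro smooth_periodic_mult smooth_periodic_const smooth_periodic_sum companion_pow_smooth_periodic U c(1))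
  have split: "(companion_op n U ^^ j) (\<lambda>k x. c k x + e 0 w k x) =
      (\<lambda>i x. (companion_op n U ^^ j) c i x + (companion_op n U ^^ j) (e 0 w) i x)" for j
    by (rule companion_pow_add[OF U c(1) e_sp[OF w]])
  show thesis
  proof (rule that[of "\<lambda>k x. c k x + e 0 w k x"])
    show "smooth_periodic (\<lambda>x. c i x + e 0 w i x)" for i
      by (rule smooth_periodic_add[OF c(1) e_sp[OF w]])
    show "(companion_op n U ^^ j) (\<lambda>k x. c k x + e 0 w k x) (n - 1) x = v j x" if "j < n - 1" for j x
      using that e_zero[of 0 j "n - 1" w x] c(2) by (simp add: split)
    show "(\<Sum>j<n. (companion_op n U ^^ j) (\<lambda>k x. c k x + e 0 w k x) j x) = 0" for x
    proof -
      have "(\<Sum>j<n. (companion_op n U ^^ j) (e 0 w) j x) = (\<Sum>j<n. w x)"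
        using e_top[of 0 _ w x] by (intro sum.cong) auto
      then show ?thesis
        using \<open>0 < n\<close> by (simp add: split sum.distrib w_def)
    qed
  qed
qed

section \<open>Existence and uniqueness of \<open>P_u\<close>\<close>

lemma mult_mat_entry:
  assumes "A \<in> carrier_mat n n" "B \<in> carrier_mat n n" "i < n" "j < n"
  shows "(A * B) $$ (i, j) = (\<Sum>k<n. A $$ (i, k) * B $$ (k, j))"
  using assms by (simp add: scalar_prod_def atLeast0LessThan)

lemma trace_mult_commute:
  fixes A B :: "real mat"
  assumes "A \<in> carrier_mat n n" "B \<in> carrier_mat n n"
  shows "(\<Sum>i<n. (A * B) $$ (i, i)) = (\<Sum>i<n. (B * A) $$ (i, i))"
proof -
  have "(\<Sum>i<n. (A * B) $$ (i, i)) = (\<Sum>i<n. \<Sum>k<n. A $$ (i, k) * B $$ (k, i))"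
    by (intro sum.cong refl mult_mat_entry assms) auto
  also have "\<dots> = (\<Sum>k<n. \<Sum>i<n. B $$ (k, i) * A $$ (i, k))"
    by (subst sum.swap) (simp add: mult.commute)
  also have "\<dots> = (\<Sum>i<n. (B * A) $$ (i, i))"
    by (intro sum.cong refl mult_mat_entry[symmetric] assms) auto
  finally show ?thesis .
qed

lemma V_n_iff:
  "M \<in> V_n n \<longleftrightarrow> M \<in> carrier_mat n n \<and>
     (\<forall>i<n. \<forall>j<n. j < n - 1 \<or> i = n - 1 \<longrightarrow> M $$ (i, j) = 0)" (is "?L \<longleftrightarrow> ?R")
proof
  assume ?R
  then have "M = mat n n (\<lambda>(i, j). if i < n - 1 \<and> j = n - 1 then M $$ (i, n - 1) else 0)"
    by (intro eq_matI) (auto simp: nat_less_le)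
  then show ?L
    unfolding V_n_def by (intro CollectI exI[of _ "\<lambda>i. M $$ (i, n - 1)"] conjI TrueI)
qed (auto simp: V_n_def)

lemma V_n_t_iff:
  "M \<in> V_n_t n \<longleftrightarrow> M \<in> carrier_mat n n \<and>
     (\<forall>i<n. \<forall>j<n. i < n - 1 \<or> j = n - 1 \<longrightarrow> M $$ (i, j) = 0)" (is "?L \<longleftrightarrow> ?R")
proof
  assume ?R
  then have "M = mat n n (\<lambda>(i, j). if i = n - 1 \<and> j < n - 1 then M $$ (n - 1, j) else 0)"
    by (intro eq_matI) (auto simp: nat_less_le)
  then show ?L
    unfolding V_n_t_def by (intro CollectI exI[of _ "\<lambda>j. M $$ (n - 1, j)"] conjI TrueI)
qed (auto simp: V_n_t_def)

lemma Cinf_S1_iff: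
  assumes "X \<subseteq> carrier_mat n n"
  shows "A \<in> Cinf_S1 n X \<longleftrightarrow>
    (\<forall>x. A x \<in> X) \<and> (\<forall>i<n. \<forall>j<n. smooth_periodic (\<lambda>x. A x $$ (i, j)))" (is "?L \<longleftrightarrow> ?R")
proof
  assume R: ?R
  have "A (x + 2 * pi) = A x" for x
  proof (rule eq_matI)
    have "A (x + 2 * pi) \<in> carrier_mat n n" "A x \<in> carrier_mat n n"
      using R assms by auto
    then show "dim_row (A (x + 2 * pi)) = dim_row (A x)" "dim_col (A (x + 2 * pi)) = dim_col (A x)"
      "\<And>i j. i < dim_row (A x) \<Longrightarrow> j < dim_col (A x) \<Longrightarrow> A (x + 2 * pi) $$ (i, j) = A x $$ (i, j)"
      using R by (auto simp: smooth_periodic_def)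
  qed
  then show ?L
    using R by (simp add: Cinf_S1_def smooth_periodic_def)
qed (simp add: Cinf_S1_def smooth_periodic_def)

lemma V_n_carrier: "V_n n \<subseteq> carrier_mat n n"
  by (auto simp: V_n_def)

lemma V_n_t_carrier: "V_n_t n \<subseteq> carrier_mat n n"
  by (auto simp: V_n_t_def)

lemma sl_carrier: "sl n \<subseteq> carrier_mat n n"
  by (auto simp: sl_def)

lemma GL_carrier: "GL n \<subseteq> carrier_mat n n"
  by (auto simp: GL_def)

section \<open>The commutator and its relation to the companion operator\<close>

lemma mderiv_carrier: "mderiv n A x \<in> carrier_mat n n"
  by (simp add: mderiv_def)

lemma lax_carrier:
  assumes "A x \<in> carrier_mat n n" "B x \<in> carrier_mat n n"
  shows "lax n A B x \<in> carrier_mat n n"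
  unfolding lax_def using assms mderiv_carrier by (metis add_carrier_mat minus_carrier_mat mult_carrier_mat)

lemma lax_entry:
  assumes "A x \<in> carrier_mat n n" "B x \<in> carrier_mat n n" "i < n" "j < n"
  shows "lax n A B x $$ (i, j) = deriv (\<lambda>t. B t $$ (i, j)) x +
    ((\<Sum>k<n. A x $$ (i, k) * B x $$ (k, j)) - (\<Sum>k<n. B x $$ (i, k) * A x $$ (k, j)))"
proof -
  have "lax n A B x $$ (i, j) =
      mderiv n B x $$ (i, j) + ((A x * B x) $$ (i, j) - (B x * A x) $$ (i, j))"
    unfolding lax_def using assms by auto
  then show ?thesis
    using assms by (simp add: mult_mat_entry[where n = n] mderiv_def del: index_mult_mat)
qed

text \<open>The trace of a commutator is 0, and the trace of \<open>B\<close> is constantly 0, so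
  its derivative vanishes. This supplies the corner entry in the existence proof.\<close>

lemma lax_trace:
  assumes A: "\<And>x. A x \<in> carrier_mat n n" and B: "\<And>x. B x \<in> sl n"
    and smooth: "\<And>i. i < n \<Longrightarrow> smooth (\<lambda>x. B x $$ (i, i))"
  shows "(\<Sum>i<n. lax n A B x $$ (i, i)) = 0"
proof -
  have B': "B x \<in> carrier_mat n n" for x
    using B by (simp add: sl_def)
  have "(\<Sum>i<n. lax n A B x $$ (i, i)) = (\<Sum>i<n. deriv (\<lambda>t. B t $$ (i, i)) x) +
      ((\<Sum>i<n. (A x * B x) $$ (i, i)) - (\<Sum>i<n. (B x * A x) $$ (i, i)))"
    by (simp add: lax_entry[where A = A and B = B, OF A B'] mult_mat_entry[OF A B'] mult_mat_entry[OF B' A]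
        sum.distrib sum_subtractf)
  also have "\<dots> = (\<Sum>i<n. deriv (\<lambda>t. B t $$ (i, i)) x)"
    by (simp add: trace_mult_commute[OF A B'])
  also have "\<dots> = deriv (\<lambda>t. \<Sum>i<n. B t $$ (i, i)) x"
    using smooth by (intro deriv_sum_on[symmetric] smooth_differentiable) auto
  also have "\<dots> = 0"
    using B by (simp add: sl_def)
  finally show ?thesis .
qed

text \<open>The value 0 beyond the matrix makes the function smooth and periodic for every index, as
  the lemmas on \<open>companion_op\<close> demand.\<close>

definition last_column :: "nat \<Rightarrow> (real \<Rightarrow> real mat) \<Rightarrow> nat \<Rightarrow> real \<Rightarrow> real" where
  "last_column n u i x = (if i < n then u x $$ (i, n - 1) else 0)"

lemma last_column_smooth_periodic:
  "u \<in> Cinf_S1 n (V_n n) \<Longrightarrow> smooth_periodic (last_column n u i)"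
  unfolding last_column_def[abs_def] Cinf_S1_iff[OF V_n_carrier]
  by (cases "i < n") (simp_all add: smooth_periodic_const)

text \<open>For \<open>j < n - 1\<close> the matrix \<open>u\<close> has zero column
  \<open>j\<close>, so right multiplication by \<open>b + u\<close> merely selects column
  \<open>j + 1\<close> of \<open>C\<close>, while left multiplication plus the derivative is the
  companion operator on column \<open>j\<close>.\<close>

lemma lax_companion:
  assumes u: "u x \<in> V_n n" and C: "C x \<in> carrier_mat n n" and "i < n" "j < n - 1"
  shows "lax n (\<lambda>x. b_mat n + u x) C x $$ (i, j) =
    companion_op n (last_column n u) (\<lambda>k x. C x $$ (k, j)) i x - C x $$ (i, j + 1)"
proof -
  have u': "u x \<in> carrier_mat n n"
    using u V_n_carrier by blast
  have A: "b_mat n + u x \<in> carrier_mat n n"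
    using u' by simp
  have entry: "(b_mat n + u x) $$ (k, l) =
      (if k = l + 1 then 1 else 0) + (if l = n - 1 then u x $$ (k, n - 1) else 0)" if "k < n" "l < n" for k l
    using that u u' by (auto simp: b_mat_def V_n_iff)
  have "(\<Sum>k<n. (b_mat n + u x) $$ (i, k) * C x $$ (k, j)) =
      (\<Sum>k<n. (if i = k + 1 then C x $$ (k, j) else 0) +
        (if k = n - 1 then u x $$ (i, n - 1) * C x $$ (k, j) else 0))"
    by (intro sum.cong refl) (simp add: entry assms algebra_simps)
  also have "\<dots> = (\<Sum>k<n. if i = k + 1 then C x $$ (k, j) else 0) + u x $$ (i, n - 1) * C x $$ (n - 1, j)"
    using assms by (simp add: sum.distrib)
  also have "(\<Sum>k<n. if i = k + 1 then C x $$ (k, j) else 0) = (if i = 0 then 0 else C x $$ (i - 1, j))"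
  proof (cases i)
    case (Suc m)
    have "(\<Sum>k<n. if i = k + 1 then C x $$ (k, j) else 0) = (\<Sum>k<n. if k = m then C x $$ (k, j) else 0)"
      by (intro sum.cong refl) (auto simp: Suc)
    then show ?thesis
      using Suc \<open>i < n\<close> by simp
  qed simp
  finally have AC: "(\<Sum>k<n. (b_mat n + u x) $$ (i, k) * C x $$ (k, j)) =
      (if i = 0 then 0 else C x $$ (i - 1, j)) + u x $$ (i, n - 1) * C x $$ (n - 1, j)" .
  have "(\<Sum>k<n. C x $$ (i, k) * (b_mat n + u x) $$ (k, j)) =
      (\<Sum>k<n. if k = j + 1 then C x $$ (i, k) else 0)"
    using assms by (intro sum.cong refl) (simp add: entry)
  then have CA: "(\<Sum>k<n. C x $$ (i, k) * (b_mat n + u x) $$ (k, j)) = C x $$ (i, j + 1)"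
    using assms by simp
  show ?thesis
    using assms by (simp add: lax_entry[where A = "\<lambda>x. b_mat n + u x" and B = C and x = x, OF A C] AC CA companion_op_def last_column_def)
qed

text \<open>Allows columns to be exchanged when they agree only inside the matrix; entries of
  \<open>C x\<close> outside its dimensions are unspecified.\<close>

lemma companion_op_cong:
  assumes "\<And>k. k < n \<Longrightarrow> c k = d k" "i < n"
  shows "companion_op n U c i = companion_op n U d i"
  using assms by (intro ext) (simp add: companion_op_def)

text \<open>This is the predicate under the definite description in \<open>P_u\<close>.\<close>

definition is_P_u :: "nat \<Rightarrow> (real \<Rightarrow> real mat) \<Rightarrow> (real \<Rightarrow> real mat) \<Rightarrow> (real \<Rightarrow> real mat) \<Rightarrow> bool" where
  "is_P_u n u v C \<longleftrightarrow> C \<in> Cinf_S1 n (sl n) \<and> (\<forall>x. pi0 n (C x) = v x) \<and>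
     lax n (\<lambda>x. b_mat n + u x) C \<in> Cinf_S1 n (V_n n)"

text \<open>The first \<open>n - 1\<close> columns of an element of \<open>V_n\<close> vanish, so by
  \<open>lax_companion\<close> each column of \<open>C\<close> is the companion operator applied to
  its predecessor.\<close>

lemma is_P_u_columns:
  assumes "is_P_u n u v C" "u \<in> Cinf_S1 n (V_n n)" "j < n" "i < n"
  defines "c \<equiv> \<lambda>i x. if i < n then C x $$ (i, 0) else 0"
  shows "(companion_op n (last_column n u) ^^ j) c i = (\<lambda>x. C x $$ (i, j))"
  using \<open>j < n\<close> \<open>i < n\<close>
proof (induction j arbitrary: i)
  case 0
  then show ?case by (simp add: c_def)
next
  case (Suc j)
  have "companion_op n (last_column n u) (\<lambda>k x. C x $$ (k, j)) i x = C x $$ (i, Suc j)" for x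
  proof -
    have "u x \<in> V_n n" "C x \<in> carrier_mat n n" "lax n (\<lambda>x. b_mat n + u x) C x \<in> V_n n"
      using assms(1,2) by (auto simp: is_P_u_def Cinf_S1_def sl_def)
    then show ?thesis
      using lax_companion[of u x n C i j] Suc.prems by (simp add: V_n_iff)
  qed
  moreover have "companion_op n (last_column n u) ((companion_op n (last_column n u) ^^ j) c) i =
      companion_op n (last_column n u) (\<lambda>k x. C x $$ (k, j)) i"
    using Suc by (intro companion_op_cong) auto
  ultimately show ?case
    by (simp add: fun_eq_iff)
qed

text \<open>The difference of the two first columns satisfies the homogeneous conditions of
  \<open>companion_unique\<close>: equal \<open>pi0\<close> gives the last rows, membership in
  \<open>sl n\<close> the trace.\<close>

lemma is_P_u_unique:
  assumes u: "u \<in> Cinf_S1 n (V_n n)" and C: "is_P_u n u v C" and D: "is_P_u n u v D"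
  shows "C = D"
proof (rule ext)
  fix x
  let ?T = "companion_op n (last_column n u)"
  define c where "c i x = (if i < n then C x $$ (i, 0) else 0)" for i x
  define d where "d i x = (if i < n then D x $$ (i, 0) else 0)" for i x
  have c: "(?T ^^ j) c i x = C x $$ (i, j)" and d: "(?T ^^ j) d i x = D x $$ (i, j)"
    if "i < n" "j < n" for i j x
    using is_P_u_columns[OF C u that(2,1)] is_P_u_columns[OF D u that(2,1)]
    by (simp_all add: c_def[abs_def] d_def[abs_def] fun_eq_iff)
  have car: "C x \<in> carrier_mat n n" "D x \<in> carrier_mat n n" for x
    using C D by (auto simp: is_P_u_def Cinf_S1_def sl_def)
  have "smooth_periodic (c i)" "smooth_periodic (d i)" for i
    unfolding c_def[abs_def] d_def[abs_def] using C D
    by (cases "i < n"; simp add: is_P_u_def Cinf_S1_iff[OF sl_carrier] smooth_periodic_const)+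
  note diff = companion_pow_diff[OF last_column_smooth_periodic[OF u] this]
  have row: "C x $$ (n - 1, j) = D x $$ (n - 1, j)" if "j < n - 1" for j x
  proof -
    have "pi0 n (C x) $$ (n - 1, j) = pi0 n (D x) $$ (n - 1, j)"
      using C D by (simp add: is_P_u_def)
    then show ?thesis
      using that by (simp add: pi0_def)
  qed
  have trace: "(\<Sum>j<n. C x $$ (j, j)) = 0" "(\<Sum>j<n. D x $$ (j, j)) = 0" for x
    using C D by (auto simp: is_P_u_def Cinf_S1_def sl_def)
  have zero: "c k x - d k x = 0" if "k < n" for k x
  proof (rule companion_unique[where c = "\<lambda>k x. c k x - d k x" and U = "last_column n u" and n = n])
    show "(?T ^^ j) (\<lambda>k x. c k x - d k x) (n - 1) x = 0" if "j < n - 1" for j x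
      using that \<open>k < n\<close> row[of j x] by (simp add: diff c d)
    show "(\<Sum>j<n. (?T ^^ j) (\<lambda>k x. c k x - d k x) j x) = 0" for x
      by (simp add: diff c d sum_subtractf trace)
  qed (fact that)
  have "c = d"
  proof (intro ext)
    fix k x
    show "c k x = d k x"
      using zero[of k x] by (cases "k < n") (simp_all add: c_def d_def)
  qed
  show "C x = D x"
    using car[of x] c d \<open>c = d\<close> by (intro eq_matI) (auto simp flip: c)
qed

lemma is_P_u_exists:
  assumes "0 < n" and u: "u \<in> Cinf_S1 n (V_n n)" and v: "v \<in> Cinf_S1 n (V_n_t n)"
  shows "\<exists>C. is_P_u n u v C"
proof -
  let ?T = "companion_op n (last_column n u)" and ?A = "\<lambda>x. b_mat n + u x"
  have v_sp: "smooth_periodic (\<lambda>x. v x $$ (n - 1, j))" if "j < n - 1" for j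
    using v that by (simp add: Cinf_S1_iff[OF V_n_t_carrier])
  obtain c where c: "\<And>i. smooth_periodic (c i)"
    and row: "\<And>j x. j < n - 1 \<Longrightarrow> (?T ^^ j) c (n - 1) x = v x $$ (n - 1, j)"
    and trace: "\<And>x. (\<Sum>j<n. (?T ^^ j) c j x) = 0"
    by (rule companion_exists[where n = n and U = "last_column n u" and v = "\<lambda>j x. v x $$ (n - 1, j)",
          OF last_column_smooth_periodic[OF u] v_sp \<open>0 < n\<close>]) (assumption, rule that)
  \<comment> \<open>The columns are the successive powers applied to \<open>c\<close>, which forces
    the first \<open>n - 1\<close> columns of the commutator to vanish.\<close>
  define C where "C x = mat n n (\<lambda>(i, j). (?T ^^ j) c i x)" for x
  have C_entry: "C x $$ (i, j) = (?T ^^ j) c i x" if "i < n" "j < n" for i j x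
    using that by (simp add: C_def)
  have C_sp: "smooth_periodic (\<lambda>x. C x $$ (i, j))" if "i < n" "j < n" for i j
    using that companion_pow_smooth_periodic[OF last_column_smooth_periodic[OF u] c]
    by (simp add: C_entry)
  have C_sl: "C x \<in> sl n" for x
    using trace[of x] by (simp add: sl_def C_def)
  have C_car: "C x \<in> carrier_mat n n" for x
    by (simp add: C_def)
  have u_V: "u x \<in> V_n n" for x
    using u by (simp add: Cinf_S1_def)
  have A_car: "?A x \<in> carrier_mat n n" for x
    using subsetD[OF V_n_carrier u_V[of x]] by simp
  have A_sp: "smooth_periodic (\<lambda>x. ?A x $$ (i, j))" if "i < n" "j < n" for i j
  proof -
    have "?A x $$ (i, j) = b_mat n $$ (i, j) + u x $$ (i, j)" for x
      using u_V V_n_carrier that by (metis carrier_matD index_add_mat(1) subsetD)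
    then show ?thesis
      using u that by (simp add: smooth_periodic_add smooth_periodic_const Cinf_S1_iff[OF V_n_carrier])
  qed
  have zero: "lax n ?A C x $$ (i, j) = 0" if "i < n" "j < n - 1" for i j x
  proof -
    have "?T (\<lambda>k x. C x $$ (k, j)) i = ?T ((?T ^^ j) c) i"
      using that by (intro companion_op_cong) (auto simp: C_entry)
    then show ?thesis
      using that by (simp add: lax_companion[OF u_V C_car] C_entry)
  qed
  \<comment> \<open>All other diagonal entries are 0 by \<open>zero\<close>, so the trace of the
    commutator is its corner entry.\<close>
  have corner: "lax n ?A C x $$ (n - 1, n - 1) = 0" for x
  proof -
    have "(\<Sum>i<n. lax n ?A C x $$ (i, i)) = (\<Sum>i<n. if i = n - 1 then lax n ?A C x $$ (i, i) else 0)"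
      by (intro sum.cong refl) (auto simp: zero)
    then show ?thesis
      using lax_trace[where A = ?A and B = C, OF A_car C_sl] C_sp smooth_periodic_smooth \<open>0 < n\<close> by simp
  qed
  have "lax n ?A C x \<in> V_n n" for x
    unfolding V_n_iff using lax_carrier[where A = ?A and B = C, OF A_car C_car] zero corner
    by (metis (no_types, lifting) One_nat_def Suc_pred \<open>0 < n\<close> less_Suc_eq)
  moreover have "smooth_periodic (\<lambda>x. lax n ?A C x $$ (i, j))" if "i < n" "j < n" for i j
    unfolding lax_entry[where A = ?A and B = C, OF A_car C_car that] using that
    by (intro smooth_periodic_add smooth_periodic_diff smooth_periodic_sum smooth_periodic_mult A_sp C_sp
        smooth_periodic_deriv) auto
  ultimately have "lax n ?A C \<in> Cinf_S1 n (V_n n)"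
    by (simp add: Cinf_S1_iff[OF V_n_carrier])
  moreover have "C \<in> Cinf_S1 n (sl n)"
    using C_sl C_sp by (simp add: Cinf_S1_iff[OF sl_carrier])
  moreover have "pi0 n (C x) = v x" for x
  proof (rule eq_matI)
    have v_V: "v x \<in> V_n_t n"
      using v by (simp add: Cinf_S1_def)
    then show "dim_row (pi0 n (C x)) = dim_row (v x)" "dim_col (pi0 n (C x)) = dim_col (v x)"
      by (auto simp: V_n_t_iff pi0_def)
    fix i j
    assume "i < dim_row (v x)" "j < dim_col (v x)"
    then have ij: "i < n" "j < n"
      using v_V by (auto simp: V_n_t_iff)
    show "pi0 n (C x) $$ (i, j) = v x $$ (i, j)"
    proof (cases "i = n - 1 \<and> j < n - 1")
      case True
      then show ?thesis
        using ij row[of j x] by (simp add: pi0_def C_entry)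
    next
      case False
      then have "i < n - 1 \<or> j = n - 1"
        using ij by linarith
      then have "v x $$ (i, j) = 0"
        using v_V ij unfolding V_n_t_iff by blast
      then show ?thesis
        using False ij by (auto simp: pi0_def)
    qed
  qed
  ultimately show ?thesis
    unfolding is_P_u_def by blast
qed

lemma is_P_u_P_u:
  assumes "0 < n" "u \<in> Cinf_S1 n (V_n n)" "v \<in> Cinf_S1 n (V_n_t n)"
  shows "is_P_u n u v (P_u n u v)"
proof -
  have "is_P_u n u v (THE C. is_P_u n u v C)"
    using is_P_u_exists[OF assms] is_P_u_unique[OF assms(2)] by (metis theI)
  then show ?thesis
    by (simp add: P_u_def is_P_u_def)
qed

section \<open>Conjugation by \<open>g\<close>\<close>

lemma minv_inverse:
  assumes "A \<in> GL n"
  shows "minv A \<in> carrier_mat n n" "A * minv A = 1\<^sub>m n" "minv A * A = 1\<^sub>m n"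
proof -
  have A: "A \<in> carrier_mat n n"
    using assms by (simp add: GL_def)
  obtain B where B: "A * B = 1\<^sub>m n" "B * A = 1\<^sub>m (dim_row B)"
    using assms A by (auto simp: GL_def invertible_mat_def inverts_mat_def)
  \<comment> \<open>Invertibility does not state the size of \<open>B\<close>; comparing column
    counts in the two identities shows that it is \<open>n\<close> by \<open>n\<close>. Then
    \<open>A\<close> is a unit of the matrix ring and \<open>mat_inverse\<close> cannot return
    \<open>None\<close>.\<close>
  have "dim_col B = n"
    using arg_cong[OF B(1), of dim_col] by simp
  moreover have "dim_row B = n"
    using arg_cong[OF B(2), of dim_col] A by simp
  ultimately have "A \<in> Units (ring_mat TYPE(real) n ())"
    using A B by (auto simp: Units_def ring_mat_def intro!: bexI[of _ B])
  then obtain C where "mat_inverse A = Some C"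
    using mat_inverse(1)[OF A, of "()"] by (cases "mat_inverse A") auto
  then show "minv A \<in> carrier_mat n n" "A * minv A = 1\<^sub>m n" "minv A * A = 1\<^sub>m n"
    using mat_inverse(2)[OF A] by (auto simp: minv_def)
qed

section \<open>Differentiability of determinants and inverse matrices\<close>

lemma field_differentiable_prod:
  fixes f :: "'i \<Rightarrow> real \<Rightarrow> real"
  shows "(\<And>i. i \<in> I \<Longrightarrow> f i field_differentiable at x) \<Longrightarrow> (\<lambda>x. \<Prod>i\<in>I. f i x) field_differentiable at x"
  by (induction I rule: infinite_finite_induct) (simp_all add: field_differentiable_mult)

text \<open>By the Leibniz formula the determinant is a finite sum of products of entries.\<close>

lemma det_field_differentiable:
  fixes M :: "real \<Rightarrow> real mat"
  assumes "\<And>x. M x \<in> carrier_mat n n"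
    and "\<And>i j. i < n \<Longrightarrow> j < n \<Longrightarrow> (\<lambda>x. M x $$ (i, j)) field_differentiable at x"
  shows "(\<lambda>x. det (M x)) field_differentiable at x"
proof -
  have "p i < n" if "p permutes {0..<n}" "i < n" for p i
    using permutes_in_image[OF that(1), of i] that(2) by simp
  then show ?thesis
    unfolding det_def'[OF assms(1)]
    by (intro field_differentiable_sum field_differentiable_mult field_differentiable_const
        field_differentiable_prod assms(2)) auto
qed

text \<open>Cramer's rule, from multiplying \<open>adj_mat A * A = det A\<close> by the inverse on
  the right. It expresses the inverse through determinants, which can be differentiated.\<close>

lemma minv_cofactor:
  assumes "A \<in> GL n" "i < n" "j < n"
  shows "det A \<noteq> 0" "minv A $$ (i, j) = cofactor A j i / det A"
proof -
  note A = subsetD[OF GL_carrier assms(1)] and inv = minv_inverse[OF assms(1)]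
  have "det A * det (minv A) = 1"
    using det_mult[OF A inv(1)] inv(2) by simp
  then show det: "det A \<noteq> 0"
    by auto
  have "adj_mat A = (adj_mat A * A) * minv A"
    using A inv adj_mat(1)[OF A] by simp
  also have "\<dots> = det A \<cdot>\<^sub>m minv A"
    using inv(1) by (simp add: adj_mat(3)[OF A] mult_smult_assoc_mat[of _ n n _ n])
  finally have "adj_mat A $$ (i, j) = det A * minv A $$ (i, j)"
    using inv(1) assms by simp
  then show "minv A $$ (i, j) = cofactor A j i / det A"
    using det A assms by (simp add: adj_mat_def)
qed

lemma minv_field_differentiable:
  assumes GL: "\<And>x. M x \<in> GL n"
    and diff: "\<And>i j. i < n \<Longrightarrow> j < n \<Longrightarrow> (\<lambda>x. M x $$ (i, j)) field_differentiable at x"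
    and ij: "i < n" "j < n"
  shows "(\<lambda>x. minv (M x) $$ (i, j)) field_differentiable at x"
proof -
  have M: "M x \<in> carrier_mat n n" for x
    using GL GL_carrier by blast
  have "(\<lambda>x. mat_delete (M x) j i $$ (k, l)) field_differentiable at x" if "k < n - 1" "l < n - 1" for k l
  proof -
    \<comment> \<open>Entries of a minor are entries of \<open>M x\<close> with indices shifted past
      the deleted row \<open>j\<close> and column \<open>i\<close>.\<close>
    have "mat_delete (M x) j i $$ (k, l) =
        M x $$ (if k < j then k else Suc k, if l < i then l else Suc l)" for x
      using that M[of x] by (simp add: mat_delete_def)
    then show ?thesis
      using that by (simp add: diff)
  qed
  then have "(\<lambda>x. det (mat_delete (M x) j i)) field_differentiable at x"
    by (intro det_field_differentiable[where n = "n - 1"] mat_delete_carrier M)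
  then have "(\<lambda>x. (- 1) ^ (j + i) * det (mat_delete (M x) j i) / det (M x)) field_differentiable at x"
    using minv_cofactor(1)[OF GL ij] det_field_differentiable[OF M diff]
    by (intro field_differentiable_divide field_differentiable_mult field_differentiable_const) auto
  then show ?thesis
    by (simp add: minv_cofactor(2)[OF GL ij] cofactor_def)
qed

section \<open>Derivatives of matrix-valued maps and of conjugates\<close>

definition entrywise_differentiable :: "nat \<Rightarrow> (real \<Rightarrow> real mat) \<Rightarrow> bool" where
  "entrywise_differentiable n M \<longleftrightarrow> (\<forall>x. M x \<in> carrier_mat n n) \<and>
     (\<forall>i<n. \<forall>j<n. \<forall>x. (\<lambda>x. M x $$ (i, j)) field_differentiable at x)"

lemma Cinf_S1_entrywise_differentiable:
  "M \<in> Cinf_S1 n X \<Longrightarrow> X \<subseteq> carrier_mat n n \<Longrightarrow> entrywise_differentiable n M"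
  by (auto simp: Cinf_S1_def entrywise_differentiable_def smooth_differentiable)

lemma entrywise_differentiable_mult:
  assumes "entrywise_differentiable n A" "entrywise_differentiable n B"
  shows "entrywise_differentiable n (\<lambda>x. A x * B x)"
    and "mderiv n (\<lambda>x. A x * B x) x = mderiv n A x * B x + A x * mderiv n B x"
proof -
  have car: "A x \<in> carrier_mat n n" "B x \<in> carrier_mat n n" for x
    using assms by (auto simp: entrywise_differentiable_def)
  have diff: "(\<lambda>x. A x $$ (i, j)) field_differentiable at x" "(\<lambda>x. B x $$ (i, j)) field_differentiable at x"
    if "i < n" "j < n" for i j x
    using assms that by (auto simp: entrywise_differentiable_def)
  have summand: "(\<lambda>x. A x $$ (i, k) * B x $$ (k, j)) field_differentiable at x"
    if "i < n" "j < n" "k \<in> {..<n}" for i j k x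
    using that by (intro field_differentiable_mult diff) auto
  show "entrywise_differentiable n (\<lambda>x. A x * B x)"
    unfolding entrywise_differentiable_def
  proof (intro conjI allI impI)
    fix i j x
    assume "i < n" "j < n"
    then show "(\<lambda>x. (A x * B x) $$ (i, j)) field_differentiable at x"
      unfolding mult_mat_entry[OF car \<open>i < n\<close> \<open>j < n\<close>] by (intro field_differentiable_sum summand)
  qed (use car in \<open>blast intro: mult_carrier_mat\<close>)
  show "mderiv n (\<lambda>x. A x * B x) x = mderiv n A x * B x + A x * mderiv n B x"
  proof (rule eq_matI)
    fix i j
    assume "i < dim_row (mderiv n A x * B x + A x * mderiv n B x)"
      "j < dim_col (mderiv n A x * B x + A x * mderiv n B x)"
    then have ij: "i < n" "j < n"
      using car[of x] by (auto simp: mderiv_def)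
    have "mderiv n (\<lambda>x. A x * B x) x $$ (i, j) = deriv (\<lambda>x. \<Sum>k<n. A x $$ (i, k) * B x $$ (k, j)) x"
      using ij by (simp add: mderiv_def mult_mat_entry[OF car ij])
    also have "\<dots> = (\<Sum>k<n. deriv (\<lambda>x. A x $$ (i, k) * B x $$ (k, j)) x)"
      by (intro deriv_sum_on summand ij)
    also have "\<dots> = (\<Sum>k<n. mderiv n A x $$ (i, k) * B x $$ (k, j)) +
        (\<Sum>k<n. A x $$ (i, k) * mderiv n B x $$ (k, j))"
      using ij diff by (simp add: mderiv_def sum.distrib)
    also have "\<dots> = (mderiv n A x * B x) $$ (i, j) + (A x * mderiv n B x) $$ (i, j)"
      by (simp add: mult_mat_entry[OF mderiv_carrier car(2) ij] mult_mat_entry[OF car(1) mderiv_carrier ij])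
    also have "\<dots> = (mderiv n A x * B x + A x * mderiv n B x) $$ (i, j)"
      using ij car(1)[of x] mderiv_carrier[of n B x] by simp
    finally show "mderiv n (\<lambda>x. A x * B x) x $$ (i, j) = (mderiv n A x * B x + A x * mderiv n B x) $$ (i, j)" .
  qed (use car[of x] in \<open>auto simp: mderiv_def\<close>)
qed

lemma mderiv_zero_imp_const:
  assumes "entrywise_differentiable n M" and zero: "\<And>x. mderiv n M x = 0\<^sub>m n n"
  shows "M x = M y"
proof (rule eq_matI)
  have car: "M x \<in> carrier_mat n n" "M y \<in> carrier_mat n n"
    using assms(1) by (auto simp: entrywise_differentiable_def)
  then show "dim_row (M x) = dim_row (M y)" "dim_col (M x) = dim_col (M y)"
    by auto
  fix i j
  assume "i < dim_row (M y)" "j < dim_col (M y)"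
  then have ij: "i < n" "j < n"
    using car by auto
  have "((\<lambda>x. M x $$ (i, j)) has_field_derivative 0) (at z)" for z
  proof -
    have "deriv (\<lambda>x. M x $$ (i, j)) z = 0"
      using arg_cong[OF zero[of z], of "\<lambda>N. N $$ (i, j)"] ij by (simp add: mderiv_def)
    then show ?thesis
      using assms(1) ij by (metis entrywise_differentiable_def field_differentiable_derivI)
  qed
  then show "M x $$ (i, j) = M y $$ (i, j)"
    using DERIV_isconst_all[of "\<lambda>x. M x $$ (i, j)"] by blast
qed

lemma add_eq_zero_mat:
  fixes X Y :: "real mat"
  assumes "X + Y = 0\<^sub>m n n" "X \<in> carrier_mat n n" "Y \<in> carrier_mat n n"
  shows "X = - Y"
proof (rule eq_matI)
  fix i j
  assume "i < dim_row (- Y)" "j < dim_col (- Y)"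
  then show "X $$ (i, j) = (- Y) $$ (i, j)"
    using arg_cong[OF assms(1), of "\<lambda>M. M $$ (i, j)"] assms(2,3) by auto
qed (use assms in auto)

text \<open>With \<open>g_x = g A\<close> and \<open>(g^-1)_x = - A g^-1\<close>, the product rule
  for \<open>g C g^-1\<close> gives \<open>g (C_x + A C - C A) g^-1\<close>.\<close>

lemma mderiv_conjugation:
  assumes g: "\<And>x. g x \<in> GL n" "entrywise_differentiable n g"
    and A: "\<And>x. A x \<in> carrier_mat n n" "\<And>x. minv (g x) * mderiv n g x = A x"
    and C: "entrywise_differentiable n C"
  shows "entrywise_differentiable n (\<lambda>x. g x * C x * minv (g x))"
    and "mderiv n (\<lambda>x. g x * C x * minv (g x)) x = g x * lax n A C x * minv (g x)"
proof -
  have h: "entrywise_differentiable n (\<lambda>x. minv (g x))"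
    using g minv_inverse(1)[OF g(1)] minv_field_differentiable[OF g(1)]
    by (simp add: entrywise_differentiable_def)
  note gC = entrywise_differentiable_mult[OF g(2) C]
  show "entrywise_differentiable n (\<lambda>x. g x * C x * minv (g x))"
    by (rule entrywise_differentiable_mult(1)[OF gC(1) h])
  define G H D E where "G = g x" and "H = minv (g x)" and "D = mderiv n C x" and "E = mderiv n (\<lambda>x. minv (g x)) x"
  have car: "G \<in> carrier_mat n n" "H \<in> carrier_mat n n" "D \<in> carrier_mat n n" "E \<in> carrier_mat n n"
    "A x \<in> carrier_mat n n" "C x \<in> carrier_mat n n" "mderiv n g x \<in> carrier_mat n n"
    using g C A(1) minv_inverse(1)[OF g(1)]
    by (auto simp: G_def H_def D_def E_def mderiv_carrier entrywise_differentiable_def)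
  have GH: "G * H = 1\<^sub>m n" and HG: "H * G = 1\<^sub>m n"
    unfolding G_def H_def using minv_inverse[OF g(1)] by auto
  have g': "mderiv n g x = G * A x"
  proof -
    have "G * A x = (G * H) * mderiv n g x"
      using car by (simp add: H_def flip: A(2))
    then show ?thesis
      using car by (simp add: GH)
  qed
  \<comment> \<open>Differentiating \<open>g^-1 g = 1\<close> gives \<open>E G + A = 0\<close>;
    multiplying by \<open>H\<close> on the right isolates \<open>E\<close>.\<close>
  have "0\<^sub>m n n = mderiv n (\<lambda>x. minv (g x) * g x) x"
    unfolding minv_inverse(3)[OF g(1)] by (auto simp: mderiv_def)
  also have "\<dots> = E * G + A x"
    unfolding entrywise_differentiable_mult(2)[OF h g(2)] A(2) E_def G_def by simp
  finally have "E * G + A x = 0\<^sub>m n n" ..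
  then have "(E * G + A x) * H = 0\<^sub>m n n"
    using car by simp
  then have "E + A x * H = 0\<^sub>m n n"
    using car by (simp add: add_mult_distrib_mat[of _ n n _ _ n] GH)
  then have E: "E = - (A x * H)"
    using car by (intro add_eq_zero_mat) auto
  have "mderiv n (\<lambda>x. g x * C x * minv (g x)) x = (G * A x * C x + G * D) * H + G * C x * E"
    unfolding entrywise_differentiable_mult(2)[OF gC(1) h] gC(2) g' by (simp add: G_def H_def D_def E_def)
  also have "\<dots> = G * (D + (A x * C x - C x * A x)) * H"
  proof -
    \<comment> \<open>Naming the two products keeps them as atoms while \<open>G\<close> and
      \<open>H\<close> are factored out on either side.\<close>
    define P Q where "P = A x * C x" and "Q = C x * A x"
    have PQ: "P \<in> carrier_mat n n" "Q \<in> carrier_mat n n"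
      using car by (auto simp: P_def Q_def)
    have "(G * A x * C x + G * D) * H + G * C x * E = (G * P * H + G * D * H) + - (G * Q * H)"
      using car by (simp add: E P_def Q_def assoc_mult_mat[of _ n n _ n _ n] mult_carrier_mat[of _ n n _ n]
          add_mult_distrib_mat[of _ n n _ _ n])
    also have "\<dots> = G * D * H + (G * P * H - G * Q * H)"
      using car PQ by (intro eq_matI) auto
    also have "\<dots> = (G * D + (G * P - G * Q)) * H"
      using car PQ by (simp add: add_mult_distrib_mat[of _ n n _ _ n] minus_mult_distrib_mat[of _ n n _ _ n]
          mult_carrier_mat[of _ n n _ n] minus_carrier_mat[of _ n n])
    also have "\<dots> = G * (D + (P - Q)) * H"
      using car PQ by (simp add: mult_add_distrib_mat[of _ n n _ n] mult_minus_distrib_mat[of _ n n _ n]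
          minus_carrier_mat[of _ n n])
    also have "\<dots> = G * (D + (A x * C x - C x * A x)) * H"
      by (simp add: P_def Q_def)
    finally show ?thesis .
  qed
  finally show "mderiv n (\<lambda>x. g x * C x * minv (g x)) x = g x * lax n A C x * minv (g x)"
    by (simp add: G_def H_def D_def lax_def)
qed

theorem corollary5p15:
  fixes n :: nat and u g v :: "real \<Rightarrow> real mat"
  assumes "n \<ge> 2"
    and "u \<in> Cinf_S1 n (V_n n)"
    and "g \<in> Cinf_S1 n (GL n)"
    and "\<forall>x. minv (g x) * mderiv n g x = b_mat n + u x"
    and "v \<in> Cinf_S1 n (V_n_t n)"
    and "\<forall>x. J2_u n u v x = 0\<^sub>m n n"
  shows "\<exists>c0 \<in> sl n. \<forall>x. v x = pi0 n (minv (g x) * c0 * g x)"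
proof -
  define C where "C = P_u n u v"
  have P: "is_P_u n u v C"
    unfolding C_def using assms by (intro is_P_u_P_u) auto
  have lax: "lax n (\<lambda>x. b_mat n + u x) C x = 0\<^sub>m n n" for x
    using assms(6) by (simp add: J2_u_def C_def)
  have g: "g x \<in> GL n" for x
    using assms(3) by (simp add: Cinf_S1_def)
  note inv = minv_inverse[OF g]
  have g_car: "g x \<in> carrier_mat n n" for x
    using g GL_carrier by blast
  have A: "b_mat n + u x \<in> carrier_mat n n" for x
  proof -
    have "u x \<in> carrier_mat n n"
      using assms(2) V_n_carrier by (auto simp: Cinf_S1_def)
    then show ?thesis
      by simp
  qed
  have C_sl: "C x \<in> sl n" for x
    using P by (simp add: is_P_u_def Cinf_S1_def)
  have C_car: "C x \<in> carrier_mat n n" for x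
    using C_sl sl_carrier by blast
  have C_diff: "entrywise_differentiable n C"
    using P Cinf_S1_entrywise_differentiable[OF _ sl_carrier] by (simp add: is_P_u_def)
  have g_diff: "entrywise_differentiable n g"
    using assms(3) by (rule Cinf_S1_entrywise_differentiable[OF _ GL_carrier])
  \<comment> \<open>The conjugate has derivative \<open>g [d_x + b + u, C] g^-1 = 0\<close>, so it
    is constant; its value \<open>K 0\<close> serves as the witness \<open>c0\<close>.\<close>
  define K where "K x = g x * C x * minv (g x)" for x
  have conj: "entrywise_differentiable n K"
    "mderiv n K x = g x * lax n (\<lambda>x. b_mat n + u x) C x * minv (g x)" for x
    unfolding K_def[abs_def]
    using mderiv_conjugation[OF g g_diff A assms(4)[rule_format] C_diff] by blast+
  have "mderiv n K x = 0\<^sub>m n n" for x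
    unfolding conj(2) lax by (simp add: right_mult_zero_mat[OF g_car] left_mult_zero_mat[OF inv(1)])
  then have const: "K x = K 0" for x
    using mderiv_zero_imp_const[OF conj(1)] by blast
  have "minv (g x) * K 0 * g x = C x" for x
  proof -
    have "minv (g x) * K x * g x = (minv (g x) * g x) * C x * (minv (g x) * g x)"
      using g_car[of x] inv(1)[of x] C_car[of x]
      by (simp add: K_def assoc_mult_mat[of _ n n _ n _ n] mult_carrier_mat[of _ n n _ n])
    then show ?thesis
      using C_car[of x] inv(3)[of x] by (simp flip: const[of x])
  qed
  then have "v x = pi0 n (minv (g x) * K 0 * g x)" for x
    using P by (simp add: is_P_u_def)
  moreover have "K 0 \<in> sl n"
  proof -
    \<comment> \<open>Conjugation preserves the trace: move \<open>minv (g 0)\<close> cyclically to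
      the front and cancel it against \<open>g 0\<close>.\<close>
    have "(\<Sum>i<n. K 0 $$ (i, i)) = (\<Sum>i<n. (minv (g 0) * (g 0 * C 0)) $$ (i, i))"
      unfolding K_def by (rule trace_mult_commute[OF mult_carrier_mat[OF g_car C_car] inv(1)])
    also have "minv (g 0) * (g 0 * C 0) = C 0"
      using C_car[of 0] by (simp add: inv(3) flip: assoc_mult_mat[OF inv(1) g_car C_car])
    finally show ?thesis
      using C_sl[of 0] mult_carrier_mat[OF mult_carrier_mat[OF g_car C_car] inv(1)] by (simp add: sl_def K_def)
  qed
  ultimately show ?thesis
    by blast
qed

end
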